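(* Let $X_1,\ldots,X_n$ be independent Bernoulli random variables with $\mathbb{P}(X_i=1)=p_i=1-\mathbb{P}(X_i=0)$, let $W_n=\sum_{i=1}^n X_i$, and let $$p=\frac1n\sum_{i=1}^n p_i,\qquad q=1-p,\qquad 0<p<1.$$ Let $\mathrm{B}_{n,p}$ be a binomial random variable with parameters $n$ and $p$. Then $$d_{sl}(W_n,\mathrm{B}_{n,p})\le \frac{2}{q^n}\sum_{i=1}^{n}|p-p_i|\,p_i \prod_{j\neq i}(1-pp_j).$$
   Context: $\mathrm{B}_{n,p}$ has $\mathbb{P}(\mathrm{B}_{n,p}=k)=\binom{n}{k}p^kq^{n-k}$, $k=0,\ldots,n$. The stop-loss metric is $d_{sl}(X,Y)=\sup_{z\in\mathbb{R}}\left|\mathbb{E}[(X-z)^+]-\mathbb{E}[(Y-z)^+]\right|$, where $x^+=\max\{x,0\}$. The product $\prod_{j\ne i}$ is over $j\in\{1,\ldots,n\}\setminus\{i\}$. *)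

theory Defs
  imports "HOL-Probability.Probability"
begin

(* The two random variables may live on different probability spaces.  The supremum is
   taken in the extended reals, so that an unbounded family has distance infinity rather
   than the unspecified value of the supremum on type real. *)
definition stop_loss_dist ::
  "'a measure \<Rightarrow> ('a \<Rightarrow> real) \<Rightarrow> 'b measure \<Rightarrow> ('b \<Rightarrow> real) \<Rightarrow> ereal" where
  "stop_loss_dist M X N Y =
     (SUP z::real. ereal \<bar>(\<integral>\<omega>. max (X \<omega> - z) 0 \<partial>M) - (\<integral>\<omega>. max (Y \<omega> - z) 0 \<partial>N)\<bar>)"

end

theory Submission
  imports Defs
begin

text \<open>
  Write \<open>d\<^sub>i = P i - p\<close>.  The proof is Hoeffding's comparison of a Poisson-binomial sum with
  the binomial of the same mean, made quantitative.  Let \<open>f\<close> be a function on the naturals whose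
  second difference lies between 0 and 1, as is the case for \<open>f k = max (k - z) 0\<close>.  As a function
  of two of its success probabilities \<open>a\<close> and \<open>b\<close>, the expectation of \<open>f\<close> at the sum has the form
  \<open>u + (a + b) v + a b w\<close>, where \<open>w\<close> is the expected second difference of \<open>f\<close> at the sum of the
  other variables, so that \<open>0 \<le> w \<le> 1\<close> (\<open>bernoulli_sum_exp_pair\<close>).  If \<open>P i > p > P j\<close>, move
  the mass \<open>\<delta> = min \<bar>d\<^sub>i\<bar> \<bar>d\<^sub>j\<bar>\<close> from \<open>i\<close> to \<open>j\<close>.  This leaves \<open>a + b\<close> alone and raises \<open>a b\<close> by
  exactly \<open>\<bar>d\<^sub>i\<bar> \<bar>d\<^sub>j\<bar>\<close>, while it lowers \<open>\<Sum> d\<^sub>k\<^sup>2\<close> by twice that amount; and at least one more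
  probability has become equal to \<open>p\<close>.  After finitely many moves all of them equal \<open>p\<close>, whence
  \<open>0 \<le> E f(B) - E f(W) \<le> (\<Sum> d\<^sub>k\<^sup>2) / 2\<close> (\<open>hoeffding_comparison\<close>).

  Since \<open>\<Sum> d\<^sub>k = 0\<close>, the right-hand side is \<open>(\<Sum> d\<^sub>k P k) / 2\<close>.  This implies the claimed
  bound: each factor \<open>1 - p P j\<close> is at least \<open>q\<close>, so the product divided by \<open>q\<^sup>n\<close> is at least 1.
\<close>

section \<open>Expectations of sums of independent Bernoulli variables\<close>

text \<open>
  The expectation of \<open>f\<close> at the number of successes, summed over the possible sets \<open>A\<close> of
  successful indices.  Indexing by a set rather than a list makes it evident that any two indices
  can be singled out.
\<close>
definition bernoulli_sum_exp :: "'i set \<Rightarrow> ('i \<Rightarrow> real) \<Rightarrow> (nat \<Rightarrow> real) \<Rightarrow> real" where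
  "bernoulli_sum_exp I P f =
     (\<Sum>A\<in>Pow I. (\<Prod>i\<in>I. if i \<in> A then P i else 1 - P i) * f (card A))"

lemma bernoulli_sum_exp_empty [simp]: "bernoulli_sum_exp {} P f = f 0"
  by (simp add: bernoulli_sum_exp_def)

lemma bernoulli_sum_exp_cong:
  assumes "\<And>i. i \<in> I \<Longrightarrow> P i = Q i"
  shows "bernoulli_sum_exp I P f = bernoulli_sum_exp I Q f"
  unfolding bernoulli_sum_exp_def
  by (intro sum.cong refl arg_cong2[where f = "(*)"] prod.cong) (simp_all add: assms)

lemma bernoulli_sum_exp_insert:
  assumes "finite I" "i \<notin> I"
  shows "bernoulli_sum_exp (insert i I) P f =
    (1 - P i) * bernoulli_sum_exp I P f + P i * bernoulli_sum_exp I P (\<lambda>k. f (Suc k))"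
proof -
  let ?w = "\<lambda>J A. \<Prod>j\<in>J. if j \<in> A then P j else 1 - P j"
  have weights: "?w (insert i I) A = (1 - P i) * ?w I A"
      "?w (insert i I) (insert i A) = P i * ?w I A"
      "card (insert i A) = Suc (card A)" if "A \<in> Pow I" for A
  proof -
    have "?w I (insert i A) = ?w I A"
      using assms by (intro prod.cong) auto
    then show "?w (insert i I) (insert i A) = P i * ?w I A"
      using assms by simp
    show "?w (insert i I) A = (1 - P i) * ?w I A"
      using assms that by auto
    show "card (insert i A) = Suc (card A)"
      using assms that by (meson PowD card_insert_disjoint finite_subset subsetD)
  qed
  have inj: "inj_on (insert i) (Pow I)"
    using assms by (auto simp: inj_on_def)
  have "bernoulli_sum_exp (insert i I) P f =
      (\<Sum>A\<in>Pow I. ?w (insert i I) A * f (card A)) +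
      (\<Sum>A\<in>insert i ` Pow I. ?w (insert i I) A * f (card A))"
    unfolding bernoulli_sum_exp_def Pow_insert
    using assms by (intro sum.union_disjoint) auto
  also have "(\<Sum>A\<in>insert i ` Pow I. ?w (insert i I) A * f (card A)) =
      (\<Sum>A\<in>Pow I. P i * (?w I A * f (Suc (card A))))"
    unfolding sum.reindex[OF inj] o_def
    by (intro sum.cong refl) (simp only: weights mult.assoc)
  also have "(\<Sum>A\<in>Pow I. ?w (insert i I) A * f (card A)) =
      (\<Sum>A\<in>Pow I. (1 - P i) * (?w I A * f (card A)))"
    by (intro sum.cong refl) (simp only: weights mult.assoc)
  finally show ?thesis
    by (simp only: bernoulli_sum_exp_def sum_distrib_left)
qed

lemma bernoulli_sum_exp_bounds:
  assumes "finite I" "\<And>i. i \<in> I \<Longrightarrow> 0 \<le> P i" "\<And>i. i \<in> I \<Longrightarrow> P i \<le> 1"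
    and "\<And>k. c \<le> f k" "\<And>k. f k \<le> d"
  shows "c \<le> bernoulli_sum_exp I P f \<and> bernoulli_sum_exp I P f \<le> d"
  using assms
proof (induction I arbitrary: f rule: finite_induct)
  case (insert i I)
  let ?u = "bernoulli_sum_exp I P f" and ?v = "bernoulli_sum_exp I P (\<lambda>k. f (Suc k))"
  have Pi: "0 \<le> P i" "P i \<le> 1"
    using insert.prems(1,2) by blast+
  have "c \<le> ?u \<and> ?u \<le> d"
    by (rule insert.IH) (use insert.prems in blast)+
  moreover have "c \<le> ?v \<and> ?v \<le> d"
    by (rule insert.IH) (use insert.prems in blast)+
  ultimately have "0 \<le> (1 - P i) * (?u - c)" "0 \<le> P i * (?v - c)"
      "0 \<le> (1 - P i) * (d - ?u)" "0 \<le> P i * (d - ?v)"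
    using Pi by simp_all
  then show ?case
    unfolding bernoulli_sum_exp_insert[OF insert.hyps] by (simp add: algebra_simps)
qed simp

text \<open>
  The two affine dependences on \<open>P i\<close> and \<open>P j\<close> combine into a symmetric bilinear one, so only the
  sum and the product of the two probabilities matter.
\<close>
lemma bernoulli_sum_exp_pair:
  assumes "finite K" "i \<notin> K" "j \<notin> K" "i \<noteq> j"
  shows "bernoulli_sum_exp (insert i (insert j K)) P f =
    bernoulli_sum_exp K P f
    + (P i + P j) * (bernoulli_sum_exp K P (\<lambda>k. f (Suc k)) - bernoulli_sum_exp K P f)
    + P i * P j * bernoulli_sum_exp K P (\<lambda>k. f (Suc (Suc k)) - 2 * f (Suc k) + f k)"
proof -
  have second_difference:
    "bernoulli_sum_exp K P (\<lambda>k. f (Suc (Suc k)) - 2 * f (Suc k) + f k) =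
      bernoulli_sum_exp K P (\<lambda>k. f (Suc (Suc k))) - 2 * bernoulli_sum_exp K P (\<lambda>k. f (Suc k))
      + bernoulli_sum_exp K P f"
    by (simp add: bernoulli_sum_exp_def algebra_simps sum.distrib sum_subtractf sum_distrib_left)
  show ?thesis
    unfolding second_difference
    using assms by (simp add: bernoulli_sum_exp_insert algebra_simps)
qed

section \<open>Comparison with equal success probabilities\<close>

text \<open>
  Hoeffding's convex-order inequality together with an upper bound for the gap.  The induction is on
  the number of indices whose probability differs from \<open>p\<close>; each mass transfer between a large
  and a small probability removes at least one of them.
\<close>
lemma hoeffding_comparison:
  fixes P :: "'i \<Rightarrow> real"
  assumes "finite I" "\<And>i. i \<in> I \<Longrightarrow> 0 \<le> P i" "\<And>i. i \<in> I \<Longrightarrow> P i \<le> 1"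
    and "(\<Sum>i\<in>I. P i - p) = 0"
    and f: "\<And>k. 0 \<le> f (Suc (Suc k)) - 2 * f (Suc k) + f k"
           "\<And>k. f (Suc (Suc k)) - 2 * f (Suc k) + f k \<le> 1"
  shows "bernoulli_sum_exp I P f \<le> bernoulli_sum_exp I (\<lambda>_. p) f \<and>
    bernoulli_sum_exp I (\<lambda>_. p) f \<le> bernoulli_sum_exp I P f + (\<Sum>i\<in>I. (P i - p)\<^sup>2) / 2"
  using assms(2-4)
proof (induction "card {i \<in> I. P i \<noteq> p}" arbitrary: P rule: less_induct)
  case less
  show ?case
  proof (cases "\<forall>i\<in>I. P i = p")
    case True
    then have "bernoulli_sum_exp I P f = bernoulli_sum_exp I (\<lambda>_. p) f"
      by (intro bernoulli_sum_exp_cong) auto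
    then show ?thesis
      by (simp add: sum_nonneg)
  next
    case False
    have "\<exists>i\<in>I. p < P i"
    proof (rule ccontr)
      assume "\<not> ?thesis"
      then have "\<forall>i\<in>I. p - P i = 0"
        using less.prems(3) \<open>finite I\<close> sum_nonneg_eq_0_iff[of I "\<lambda>i. p - P i"]
        by (auto simp: sum_subtractf not_less)
      with False show False by auto
    qed
    then obtain i where i: "i \<in> I" "p < P i" by blast
    have "\<exists>j\<in>I. P j < p"
    proof (rule ccontr)
      assume "\<not> ?thesis"
      then have "\<forall>j\<in>I. P j - p = 0"
        using less.prems(3) \<open>finite I\<close> sum_nonneg_eq_0_iff[of I "\<lambda>j. P j - p"]
        by (auto simp: not_less)
      with False show False by auto
    qed
    then obtain j where j: "j \<in> I" "P j < p" by blast
    define K where "K = I - {i, j}"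
    define \<delta> where "\<delta> = min (P i - p) (p - P j)"
    define Q where "Q = P(i := P i - \<delta>, j := P j + \<delta>)"
    have ij: "i \<noteq> j" using i j by auto
    have I: "I = insert i (insert j K)" and K: "finite K" "i \<notin> K" "j \<notin> K"
      using i j \<open>finite I\<close> by (auto simp: K_def)
    have Qi: "Q i = P i - \<delta>" and Qj: "Q j = P j + \<delta>" and QK: "\<And>k. k \<in> K \<Longrightarrow> Q k = P k"
      using ij K by (auto simp: Q_def)
    have \<delta>: "0 < \<delta>" "\<delta> \<le> P i - p" "\<delta> \<le> p - P j"
      using i j by (auto simp: \<delta>_def)
    have Qsum: "(\<Sum>k\<in>I. Q k - p) = 0"
      using less.prems(3) ij K QK by (simp add: I Qi Qj cong: sum.cong)
    \<comment> \<open>\<open>\<delta>\<close> is one of the two deviations, so \<open>P i - P j - \<delta>\<close> is the other one.\<close>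
    have prod_ij: "\<delta> * (P i - P j - \<delta>) = (P i - p) * (p - P j)"
      by (auto simp: \<delta>_def min_def)
    have prodQ: "Q i * Q j = P i * P j + (P i - p) * (p - P j)"
      using prod_ij by (simp add: Qi Qj algebra_simps)
    have "(Q i - p)\<^sup>2 + (Q j - p)\<^sup>2 =
        (P i - p)\<^sup>2 + (P j - p)\<^sup>2 - 2 * (\<delta> * (P i - P j - \<delta>))"
      by (simp add: Qi Qj power2_eq_square algebra_simps)
    then have squares: "(\<Sum>k\<in>I. (Q k - p)\<^sup>2) =
        (\<Sum>k\<in>I. (P k - p)\<^sup>2) - 2 * ((P i - p) * (p - P j))"
      unfolding prod_ij using ij K QK by (simp add: I cong: sum.cong)
    have "Q i = p \<or> Q j = p"
      by (auto simp: Qi Qj \<delta>_def)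
    then obtain l where l: "l = i \<or> l = j" "Q l = p" by auto
    have "{k \<in> I. Q k \<noteq> p} \<subseteq> {k \<in> I. P k \<noteq> p}"
      using i j by (auto simp: Q_def)
    moreover have "l \<in> {k \<in> I. P k \<noteq> p}" "l \<notin> {k \<in> I. Q k \<noteq> p}"
      using i j l by auto
    ultimately have "{k \<in> I. Q k \<noteq> p} \<subset> {k \<in> I. P k \<noteq> p}"
      unfolding psubset_eq by metis
    then have "card {k \<in> I. Q k \<noteq> p} < card {k \<in> I. P k \<noteq> p}"
      using \<open>finite I\<close> by (intro psubset_card_mono) auto
    moreover have "0 \<le> Q k \<and> Q k \<le> 1" if "k \<in> I" for k
    proof (cases "k \<in> K")
      case True
      then show ?thesis using less.prems(1,2) that QK by simp
    next
      case False
      then have "k = i \<or> k = j" using that I by auto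
      then show ?thesis
        using less.prems(1)[OF i(1)] less.prems(1)[OF j(1)] less.prems(2)[OF i(1)]
          less.prems(2)[OF j(1)] \<delta> i j by (auto simp: Qi Qj)
    qed
    ultimately have IH: "bernoulli_sum_exp I Q f \<le> bernoulli_sum_exp I (\<lambda>_. p) f"
      "bernoulli_sum_exp I (\<lambda>_. p) f \<le> bernoulli_sum_exp I Q f + (\<Sum>k\<in>I. (Q k - p)\<^sup>2) / 2"
      using less.hyps[of Q] Qsum by auto
    define w where "w = bernoulli_sum_exp K P (\<lambda>k. f (Suc (Suc k)) - 2 * f (Suc k) + f k)"
    have w: "0 \<le> w" "w \<le> 1"
      unfolding w_def using bernoulli_sum_exp_bounds[OF K(1), of P 0 _ 1] less.prems(1,2) f
      by (auto simp: I)
    have same: "bernoulli_sum_exp K Q g = bernoulli_sum_exp K P g" for g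
      using QK by (rule bernoulli_sum_exp_cong)
    have sumQ: "Q i + Q j = P i + P j" by (simp add: Qi Qj)
    have transfer: "bernoulli_sum_exp I Q f =
        bernoulli_sum_exp I P f + (P i - p) * (p - P j) * w"
      unfolding I bernoulli_sum_exp_pair[OF K ij] same prodQ sumQ w_def[symmetric]
      by (simp add: algebra_simps)
    have pos: "0 \<le> (P i - p) * (p - P j)" using i j by simp
    then have "0 \<le> (P i - p) * (p - P j) * w" "(P i - p) * (p - P j) * w \<le> (P i - p) * (p - P j)"
      using w by (simp_all add: mult_left_le)
    then show ?thesis
      using IH transfer squares by linarith
  qed
qed

section \<open>The sums of the theorem as expectations\<close>

text \<open>
  Almost surely every \<open>X i\<close> is 0 or 1, and then exactly one of the events "the set of successes
  is \<open>A\<close>" occurs; independence gives its probability as a product.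
\<close>
lemma (in prob_space) expectation_bernoulli_sum:
  fixes X :: "'i \<Rightarrow> 'a \<Rightarrow> real" and g :: "real \<Rightarrow> real"
  assumes indep: "indep_vars (\<lambda>_. borel) X I" and I: "finite I" "I \<noteq> {}"
    and P1: "\<And>i. i \<in> I \<Longrightarrow> prob {\<omega> \<in> space M. X i \<omega> = 1} = P i"
    and P0: "\<And>i. i \<in> I \<Longrightarrow> prob {\<omega> \<in> space M. X i \<omega> = 0} = 1 - P i"
    and g: "g \<in> borel_measurable borel"
  shows "expectation (\<lambda>\<omega>. g (\<Sum>i\<in>I. X i \<omega>)) = bernoulli_sum_exp I P (\<lambda>k. g (real k))"
proof -
  have X [measurable]: "X i \<in> borel_measurable M" if "i \<in> I" for i
    using indep that unfolding indep_vars_def by auto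
  note g [measurable]
  define E where "E A = (\<Inter>i\<in>I. X i -` {if i \<in> A then 1 else 0} \<inter> space M)" for A
  have E [measurable]: "E A \<in> events" for A
    unfolding E_def using I by (intro sets.finite_INT measurable_sets[OF X]) auto
  have prob_E: "prob (E A) = (\<Prod>i\<in>I. if i \<in> A then P i else 1 - P i)" for A
  proof -
    have "prob (E A) = (\<Prod>i\<in>I. prob (X i -` {if i \<in> A then 1 else 0} \<inter> space M))"
      unfolding E_def using I by (intro indep_varsD[OF indep]) auto
    also have "\<dots> = (\<Prod>i\<in>I. if i \<in> A then P i else 1 - P i)"
    proof (intro prod.cong refl)
      fix i assume "i \<in> I"
      have "X i -` {c} \<inter> space M = {\<omega> \<in> space M. X i \<omega> = c}" for c by auto
      with \<open>i \<in> I\<close> show "prob (X i -` {if i \<in> A then 1 else 0} \<inter> space M) =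
          (if i \<in> A then P i else 1 - P i)"
        by (simp add: P0 P1)
    qed
    finally show ?thesis .
  qed
  have "AE \<omega> in M. X i \<omega> = 1 \<or> X i \<omega> = 0" if i: "i \<in> I" for i
  proof -
    note X[OF i, measurable]
    have "prob ({\<omega> \<in> space M. X i \<omega> = 1} \<union> {\<omega> \<in> space M. X i \<omega> = 0}) = 1"
      by (subst finite_measure_Union) (auto simp: P0 P1 i)
    then have "AE \<omega> in M. \<omega> \<in> {\<omega> \<in> space M. X i \<omega> = 1} \<union> {\<omega> \<in> space M. X i \<omega> = 0}"
      by (subst (asm) prob_eq_1) auto
    then show ?thesis by eventually_elim auto
  qed
  then have "AE \<omega> in M. \<forall>i\<in>I. X i \<omega> = 1 \<or> X i \<omega> = 0"
    using I by (intro AE_finite_allI) auto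
  with AE_space have decomposition: "AE \<omega> in M. g (\<Sum>i\<in>I. X i \<omega>) =
      (\<Sum>A\<in>Pow I. indicator (E A) \<omega> * g (real (card A)))"
  proof eventually_elim
    case (elim \<omega>)
    define S where "S = {i \<in> I. X i \<omega> = 1}"
    have "(\<Sum>i\<in>I. X i \<omega>) = (\<Sum>i\<in>I. if X i \<omega> = 1 then 1 else 0)"
      using elim by (intro sum.cong) auto
    also have "\<dots> = real (card S)"
      using I by (simp add: S_def sum.If_cases Int_def)
    finally have sum_eq: "(\<Sum>i\<in>I. X i \<omega>) = real (card S)" .
    have "\<omega> \<in> E A \<longleftrightarrow> A = S" if "A \<in> Pow I" for A
      using that elim I by (auto simp: E_def S_def split: if_splits)
    then have "(\<Sum>A\<in>Pow I. indicator (E A) \<omega> * g (real (card A))) =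
        (\<Sum>A\<in>Pow I. if A = S then g (real (card S)) else 0)"
      by (intro sum.cong) (auto simp: indicator_def)
    also have "\<dots> = g (real (card S))"
      using I by (subst sum.delta) (auto simp: S_def)
    finally show ?case by (simp add: sum_eq)
  qed
  have "expectation (\<lambda>\<omega>. g (\<Sum>i\<in>I. X i \<omega>)) =
      expectation (\<lambda>\<omega>. \<Sum>A\<in>Pow I. indicator (E A) \<omega> * g (real (card A)))"
    by (intro integral_cong_AE decomposition) measurable
  also have "\<dots> = (\<Sum>A\<in>Pow I. prob (E A) * g (real (card A)))"
    by (subst Bochner_Integration.integral_sum)
      (auto intro!: integrable_real_mult_indicator sum.cong simp: integrable_indicator_iff less_top[symmetric])
  finally show ?thesis
    by (simp add: prob_E bernoulli_sum_exp_def)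
qed

lemma expectation_binomial_eq_bernoulli_sum_exp:
  assumes "finite I" "0 \<le> p" "p \<le> 1"
  shows "measure_pmf.expectation (binomial_pmf (card I) p) f = bernoulli_sum_exp I (\<lambda>_. p) f"
  using assms(1)
proof (induction I arbitrary: f rule: finite_induct)
  case empty
  then show ?case using assms by (simp add: binomial_pmf_0)
next
  case (insert i I)
  have "binomial_pmf (card (insert i I)) p = bernoulli_pmf p \<bind>
      (\<lambda>b. map_pmf (\<lambda>k. (if b then 1 else 0) + k) (binomial_pmf (card I) p))"
    using assms insert.hyps by (simp add: binomial_pmf_Suc map_pmf_def)
  then have "measure_pmf.expectation (binomial_pmf (card (insert i I)) p) f =
      (\<Sum>b\<in>UNIV. pmf (bernoulli_pmf p) b *\<^sub>R
        measure_pmf.expectation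
          (map_pmf (\<lambda>k. (if b then 1 else 0) + k) (binomial_pmf (card I) p)) f)"
    using assms by (simp only:) (intro pmf_expectation_bind; simp add: set_pmf_binomial_eq)
  also have "\<dots> = (1 - p) * bernoulli_sum_exp I (\<lambda>_. p) f
      + p * bernoulli_sum_exp I (\<lambda>_. p) (\<lambda>k. f (Suc k))"
    using assms by (simp add: UNIV_bool insert.IH)
  finally show ?case
    by (simp add: bernoulli_sum_exp_insert[OF insert.hyps])
qed

section \<open>The bound on the stop-loss distance\<close>

text \<open>
  Because the deviations from the mean sum to zero, \<open>\<Sum> (P i - p)\<^sup>2 = \<Sum> (P i - p) P i\<close>.  This
  brings in the weights \<open>P i\<close>; the remaining factors only weaken the bound.
\<close>
lemma sum_square_deviation_le:
  fixes P :: "'i \<Rightarrow> real"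
  assumes "finite I" "\<And>i. i \<in> I \<Longrightarrow> 0 \<le> P i" "\<And>i. i \<in> I \<Longrightarrow> P i \<le> 1"
    and "(\<Sum>i\<in>I. P i - p) = 0" "0 \<le> p" "p < 1"
  shows "(\<Sum>i\<in>I. (P i - p)\<^sup>2) / 2 \<le>
    2 / (1 - p) ^ card I * (\<Sum>i\<in>I. \<bar>p - P i\<bar> * P i * (\<Prod>j\<in>I - {i}. 1 - p * P j))"
proof -
  have "(\<Sum>i\<in>I. (P i - p)\<^sup>2) = (\<Sum>i\<in>I. (P i - p) * P i) - p * (\<Sum>i\<in>I. P i - p)"
    by (simp add: power2_eq_square algebra_simps sum_subtractf sum.distrib sum_distrib_left)
  then have "(\<Sum>i\<in>I. (P i - p)\<^sup>2) / 2 = (\<Sum>i\<in>I. (P i - p) * P i) / 2"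
    using assms(4) by simp
  also have "\<dots> \<le> (\<Sum>i\<in>I. \<bar>p - P i\<bar> * P i) / 2"
    using assms(2) by (intro divide_right_mono sum_mono mult_right_mono) auto
  also have "\<dots> \<le> 2 * (\<Sum>i\<in>I. \<bar>p - P i\<bar> * P i)"
    using sum_nonneg[of I "\<lambda>i. \<bar>p - P i\<bar> * P i"] assms(2) by simp
  also have "\<dots> \<le> 2 * ((\<Sum>i\<in>I. \<bar>p - P i\<bar> * P i * (\<Prod>j\<in>I - {i}. 1 - p * P j)) / (1 - p) ^ card I)"
    unfolding sum_divide_distrib
  proof (intro mult_left_mono sum_mono)
    fix i assume i: "i \<in> I"
    have "(1 - p) ^ card I \<le> (1 - p) ^ card (I - {i})"
      using assms by (intro power_decreasing card_mono) auto
    also have "\<dots> = (\<Prod>j\<in>I - {i}. 1 - p)" by simp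
    also have "\<dots> \<le> (\<Prod>j\<in>I - {i}. 1 - p * P j)"
      using assms by (intro prod_mono) (auto simp: mult_left_le)
    finally have "1 \<le> (\<Prod>j\<in>I - {i}. 1 - p * P j) / (1 - p) ^ card I"
      using assms by simp
    then have "\<bar>p - P i\<bar> * P i * 1 \<le>
        \<bar>p - P i\<bar> * P i * ((\<Prod>j\<in>I - {i}. 1 - p * P j) / (1 - p) ^ card I)"
      using assms(2)[OF i] by (intro mult_left_mono) auto
    then show "\<bar>p - P i\<bar> * P i \<le>
        \<bar>p - P i\<bar> * P i * (\<Prod>j\<in>I - {i}. 1 - p * P j) / (1 - p) ^ card I"
      by simp
  qed auto
  finally show ?thesis by simp
qed

theorem corollary3p1:
  fixes M :: "'a measure" and N :: "'b measure"
    and X :: "nat \<Rightarrow> 'a \<Rightarrow> real" and B :: "'b \<Rightarrow> real"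
    and n :: nat and P :: "nat \<Rightarrow> real" and p q :: real
  assumes "prob_space M"
    and "prob_space.indep_vars M (\<lambda>_. borel) X {1..n}"
    and "\<And>i. i \<in> {1..n} \<Longrightarrow> measure M {\<omega> \<in> space M. X i \<omega> = 1} = P i"
    and "\<And>i. i \<in> {1..n} \<Longrightarrow> measure M {\<omega> \<in> space M. X i \<omega> = 0} = 1 - P i"
    and "p = (\<Sum>i=1..n. P i) / real n"
    and "q = 1 - p"
    and "0 < p" and "p < 1"
    and "prob_space N"
    and "B \<in> borel_measurable N"
    and "distr N borel B = distr (measure_pmf (binomial_pmf n p)) borel real"
  shows "stop_loss_dist M (\<lambda>\<omega>. \<Sum>i=1..n. X i \<omega>) N B
    \<le> ereal (2 / q ^ n * (\<Sum>i=1..n. \<bar>p - P i\<bar> * P i * (\<Prod>j\<in>{1..n} - {i}. 1 - p * P j)))"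
  unfolding stop_loss_dist_def
proof (rule SUP_least)
  interpret M: prob_space M by fact
  fix z :: real
  define f where "f k = max (real k - z) 0" for k
  have n: "n \<noteq> 0" using assms(5,7) by (cases n) auto
  have P: "0 \<le> P i" "P i \<le> 1" if "i \<in> {1..n}" for i
    using assms(3,4)[OF that] measure_nonneg[of M] by (metis, metis diff_ge_0_iff_ge)
  have mean: "(\<Sum>i=1..n. P i - p) = 0"
    using assms(5) n by (simp add: sum_subtractf)
  have W: "(\<integral>\<omega>. max ((\<Sum>i=1..n. X i \<omega>) - z) 0 \<partial>M) = bernoulli_sum_exp {1..n} P f"
    unfolding f_def
    using M.expectation_bernoulli_sum[OF assms(2), of P "\<lambda>x. max (x - z) 0"] assms(3,4) n by simp
  have "(\<integral>\<omega>. max (B \<omega> - z) 0 \<partial>N) = (\<integral>x. max (x - z) 0 \<partial>distr N borel B)"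
    using assms(10) by (subst integral_distr) auto
  also have "\<dots> = measure_pmf.expectation (binomial_pmf n p) f"
    unfolding assms(11) f_def by (subst integral_distr) auto
  also have "\<dots> = bernoulli_sum_exp {1..n} (\<lambda>_. p) f"
    using expectation_binomial_eq_bernoulli_sum_exp[of "{1..n}" p f] assms(7,8) by simp
  finally have B: "(\<integral>\<omega>. max (B \<omega> - z) 0 \<partial>N) = bernoulli_sum_exp {1..n} (\<lambda>_. p) f" .
  have "0 \<le> f (Suc (Suc k)) - 2 * f (Suc k) + f k"
    "f (Suc (Suc k)) - 2 * f (Suc k) + f k \<le> 1" for k
    by (auto simp: f_def max_def)
  then have "bernoulli_sum_exp {1..n} P f \<le> bernoulli_sum_exp {1..n} (\<lambda>_. p) f \<and>
      bernoulli_sum_exp {1..n} (\<lambda>_. p) f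
        \<le> bernoulli_sum_exp {1..n} P f + (\<Sum>i=1..n. (P i - p)\<^sup>2) / 2"
    by (intro hoeffding_comparison P mean) auto
  then have "\<bar>bernoulli_sum_exp {1..n} P f - bernoulli_sum_exp {1..n} (\<lambda>_. p) f\<bar>
      \<le> (\<Sum>i=1..n. (P i - p)\<^sup>2) / 2"
    by linarith
  also have "\<dots> \<le> 2 / q ^ n * (\<Sum>i=1..n. \<bar>p - P i\<bar> * P i * (\<Prod>j\<in>{1..n} - {i}. 1 - p * P j))"
    using sum_square_deviation_le[of "{1..n}" P p] P mean assms(6-8) by simp
  finally show "ereal \<bar>(\<integral>\<omega>. max ((\<Sum>i=1..n. X i \<omega>) - z) 0 \<partial>M) - (\<integral>\<omega>. max (B \<omega> - z) 0 \<partial>N)\<bar>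
      \<le> ereal (2 / q ^ n * (\<Sum>i=1..n. \<bar>p - P i\<bar> * P i * (\<Prod>j\<in>{1..n} - {i}. 1 - p * P j)))"
    unfolding W B ereal_less_eq .
qed

end
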